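(* Let $q$ be a positive prime integer. The following statements hold: (i) if $q\equiv 1 \pmod 3$ or $q=3$, then the algebra $\mathbb{H}_{\mathbb{Q}}(-3,q)$ is split; (ii) if $q\equiv 1,9 \pmod{20}$ or $q=5$, then the algebra $\mathbb{H}_{\mathbb{Q}}(-5,q)$ is split; (iii) if $q\equiv 1,7 \pmod{24}$, then the algebra $\mathbb{H}_{\mathbb{Q}}(-6,q)$ is split; (iv) if $q\equiv 1,2,4 \pmod 7$ or $q=7$, then the algebra $\mathbb{H}_{\mathbb{Q}}(-7,q)$ is split; (v) if $q\equiv 1,9,11,19 \pmod{40}$, then the algebra $\mathbb{H}_{\mathbb{Q}}(-10,q)$ is split; (vi) if $q\equiv 1,9,17,25,29,49 \pmod{52}$, then the algebra $\mathbb{H}_{\mathbb{Q}}(-13,q)$ is split; (vii) if $q\equiv 1,9,15,23,25,39 \pmod{56}$, then the algebra $\mathbb{H}_{\mathbb{Q}}(-14,q)$ is split; (viii) if $q\equiv 1,19,31,49 \pmod{60}$, then the algebra $\mathbb{H}_{\mathbb{Q}}(-15,q)$ is split; (ix) if $q\equiv 1,25,37 \pmod{84}$, then the algebra $\mathbb{H}_{\mathbb{Q}}(-21,q)$ is split; (x) if $q\equiv 1,9,15,23,25,31,47,49,71,81 \pmod{88}$, then the algebra $\mathbb{H}_{\mathbb{Q}}(-22,q)$ is split; (xi) if $q\equiv 1,31,49,79 \pmod{120}$, then the algebra $\mathbb{H}_{\mathbb{Q}}(-30,q)$ is split.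
   Context: For a field $K$ with $\operatorname{char} K\neq 2$ and $\alpha,\beta\in K^{*}$, $\mathbb{H}_{K}(\alpha,\beta)$ denotes the generalized quaternion algebra over $K$ with basis $\{1,e_1,e_2,e_3\}$ and multiplication determined by $e_1^2=\alpha$, $e_2^2=\beta$, $e_1e_2=e_3=-e_2e_1$ (so $e_3^2=-\alpha\beta$). It is called split if it is isomorphic to a matrix algebra over $K$, i.e. to $M_2(K)$. A notation such as $q\equiv a,b,c \pmod m$ means that $q$ is congruent modulo $m$ to one of the listed residues. *)

theory Defs
  imports "Jordan_Normal_Form.Matrix" "HOL-Algebra.QuotRing" "HOL-Computational_Algebra.Primes"
begin

text \<open>
  \<open>Quat a0 a1 a2 a3\<close> stands for \<open>a0 + a1 e1 + a2 e2 + a3 e3\<close>. The parameters \<open>\<alpha>, \<beta>\<close> of the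
  quaternion algebra enter only through the multiplication.
\<close>

datatype 'a quat = Quat 'a 'a 'a 'a

fun quat_add :: "'a::field quat \<Rightarrow> 'a quat \<Rightarrow> 'a quat" where
  "quat_add (Quat a0 a1 a2 a3) (Quat b0 b1 b2 b3) =
     Quat (a0 + b0) (a1 + b1) (a2 + b2) (a3 + b3)"

fun quat_smult :: "'a::field \<Rightarrow> 'a quat \<Rightarrow> 'a quat" where
  "quat_smult c (Quat a0 a1 a2 a3) = Quat (c * a0) (c * a1) (c * a2) (c * a3)"

text \<open>
  The bilinear extension of \<open>e1\<^sup>2 = \<alpha>\<close>, \<open>e2\<^sup>2 = \<beta>\<close>, \<open>e1 e2 = e3 = - e2 e1\<close>. Associativity forces
  \<open>e3\<^sup>2 = - \<alpha> \<beta>\<close>, \<open>e1 e3 = \<alpha> e2 = - e3 e1\<close> and \<open>e3 e2 = \<beta> e1 = - e2 e3\<close>.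
\<close>

fun quat_mult :: "'a::field \<Rightarrow> 'a \<Rightarrow> 'a quat \<Rightarrow> 'a quat \<Rightarrow> 'a quat" where
  "quat_mult \<alpha> \<beta> (Quat a0 a1 a2 a3) (Quat b0 b1 b2 b3) =
     Quat (a0 * b0 + \<alpha> * a1 * b1 + \<beta> * a2 * b2 - \<alpha> * \<beta> * a3 * b3)
          (a0 * b1 + a1 * b0 - \<beta> * a2 * b3 + \<beta> * a3 * b2)
          (a0 * b2 + a2 * b0 + \<alpha> * a1 * b3 - \<alpha> * a3 * b1)
          (a0 * b3 + a3 * b0 + a1 * b2 - a2 * b1)"

text \<open>
  A \<open>K\<close>-algebra is represented by a module record, which carries both the ring operations and
  the scalar multiplication. (The library locale \<open>algebra\<close> is restricted to commutative algebras.)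
  The base field is the whole type; the notion is the intended one if its characteristic is not 2
  and \<open>\<alpha>\<close>, \<open>\<beta>\<close> are nonzero.
\<close>

definition quaternion_algebra :: "'a::field \<Rightarrow> 'a \<Rightarrow> ('a, 'a quat) module" where
  "quaternion_algebra \<alpha> \<beta> =
     \<lparr>carrier = UNIV, mult = quat_mult \<alpha> \<beta>, one = Quat 1 0 0 0,
      zero = Quat 0 0 0 0, add = quat_add, smult = quat_smult\<rparr>"

definition algebra_isomorphic :: "('k, 'a) module \<Rightarrow> ('k, 'b) module \<Rightarrow> bool" where
  "algebra_isomorphic A B \<longleftrightarrow>
     (\<exists>h \<in> ring_iso A B. \<forall>c. \<forall>x \<in> carrier A. h (c \<odot>\<^bsub>A\<^esub> x) = c \<odot>\<^bsub>B\<^esub> h x)"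

definition split_algebra :: "('k::field, 'a) module \<Rightarrow> bool" where
  "split_algebra A \<longleftrightarrow> algebra_isomorphic A (module_mat TYPE('k) 2 2)"

lemma quaternion_algebra_relations:
  fixes \<alpha> \<beta> :: "'a::field"
  defines "H \<equiv> quaternion_algebra \<alpha> \<beta>"
    and "e1 \<equiv> Quat 0 1 0 0" and "e2 \<equiv> Quat 0 0 1 0" and "e3 \<equiv> Quat 0 0 0 1"
  shows "e1 \<otimes>\<^bsub>H\<^esub> e1 = \<alpha> \<odot>\<^bsub>H\<^esub> \<one>\<^bsub>H\<^esub>" "e2 \<otimes>\<^bsub>H\<^esub> e2 = \<beta> \<odot>\<^bsub>H\<^esub> \<one>\<^bsub>H\<^esub>"
    "e3 \<otimes>\<^bsub>H\<^esub> e3 = (- \<alpha> * \<beta>) \<odot>\<^bsub>H\<^esub> \<one>\<^bsub>H\<^esub>"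
    "e1 \<otimes>\<^bsub>H\<^esub> e2 = e3" "e2 \<otimes>\<^bsub>H\<^esub> e1 = (- 1) \<odot>\<^bsub>H\<^esub> e3"
    "Quat a0 a1 a2 a3 =
       a0 \<odot>\<^bsub>H\<^esub> \<one>\<^bsub>H\<^esub> \<oplus>\<^bsub>H\<^esub> a1 \<odot>\<^bsub>H\<^esub> e1 \<oplus>\<^bsub>H\<^esub> a2 \<odot>\<^bsub>H\<^esub> e2 \<oplus>\<^bsub>H\<^esub> a3 \<odot>\<^bsub>H\<^esub> e3"
  by (simp_all add: assms quaternion_algebra_def)

lemma quaternion_algebra_ring: "ring (quaternion_algebra \<alpha> \<beta>)"
proof (rule ringI)
  let ?H = "quaternion_algebra \<alpha> \<beta>"
  show "abelian_group ?H"
  proof (rule abelian_groupI)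
    fix x assume "x \<in> carrier ?H"
    show "\<exists>y \<in> carrier ?H. y \<oplus>\<^bsub>?H\<^esub> x = \<zero>\<^bsub>?H\<^esub>"
      by (rule bexI[of _ "quat_smult (- 1) x"]; cases x) (simp_all add: quaternion_algebra_def)
  next
    fix x y z
    show "x \<oplus>\<^bsub>?H\<^esub> y \<oplus>\<^bsub>?H\<^esub> z = x \<oplus>\<^bsub>?H\<^esub> (y \<oplus>\<^bsub>?H\<^esub> z)"
      by (cases x; cases y; cases z) (simp add: quaternion_algebra_def)
    show "x \<oplus>\<^bsub>?H\<^esub> y = y \<oplus>\<^bsub>?H\<^esub> x"
      by (cases x; cases y) (simp add: quaternion_algebra_def)
    show "\<zero>\<^bsub>?H\<^esub> \<oplus>\<^bsub>?H\<^esub> x = x"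
      by (cases x) (simp add: quaternion_algebra_def)
  qed (simp_all add: quaternion_algebra_def)
  show "monoid ?H"
  proof (rule monoidI)
    fix x y z
    show "x \<otimes>\<^bsub>?H\<^esub> y \<otimes>\<^bsub>?H\<^esub> z = x \<otimes>\<^bsub>?H\<^esub> (y \<otimes>\<^bsub>?H\<^esub> z)"
      by (cases x; cases y; cases z) (simp add: quaternion_algebra_def algebra_simps)
    show "\<one>\<^bsub>?H\<^esub> \<otimes>\<^bsub>?H\<^esub> x = x" "x \<otimes>\<^bsub>?H\<^esub> \<one>\<^bsub>?H\<^esub> = x"
      by (cases x; simp add: quaternion_algebra_def)+
  qed (simp_all add: quaternion_algebra_def)
  fix x y z
  show "(x \<oplus>\<^bsub>?H\<^esub> y) \<otimes>\<^bsub>?H\<^esub> z = x \<otimes>\<^bsub>?H\<^esub> z \<oplus>\<^bsub>?H\<^esub> y \<otimes>\<^bsub>?H\<^esub> z"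
    "z \<otimes>\<^bsub>?H\<^esub> (x \<oplus>\<^bsub>?H\<^esub> y) = z \<otimes>\<^bsub>?H\<^esub> x \<oplus>\<^bsub>?H\<^esub> z \<otimes>\<^bsub>?H\<^esub> y"
    by (cases x; cases y; cases z; simp add: quaternion_algebra_def algebra_simps)+
qed

lemma quaternion_algebra_smult:
  fixes \<alpha> \<beta> :: "'a::field"
  defines "H \<equiv> quaternion_algebra \<alpha> \<beta>"
  shows "c \<odot>\<^bsub>H\<^esub> (x \<oplus>\<^bsub>H\<^esub> y) = c \<odot>\<^bsub>H\<^esub> x \<oplus>\<^bsub>H\<^esub> c \<odot>\<^bsub>H\<^esub> y"
    "(c + d) \<odot>\<^bsub>H\<^esub> x = c \<odot>\<^bsub>H\<^esub> x \<oplus>\<^bsub>H\<^esub> d \<odot>\<^bsub>H\<^esub> x"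
    "(c * d) \<odot>\<^bsub>H\<^esub> x = c \<odot>\<^bsub>H\<^esub> (d \<odot>\<^bsub>H\<^esub> x)" "1 \<odot>\<^bsub>H\<^esub> x = x"
    "c \<odot>\<^bsub>H\<^esub> (x \<otimes>\<^bsub>H\<^esub> y) = (c \<odot>\<^bsub>H\<^esub> x) \<otimes>\<^bsub>H\<^esub> y"
    "c \<odot>\<^bsub>H\<^esub> (x \<otimes>\<^bsub>H\<^esub> y) = x \<otimes>\<^bsub>H\<^esub> (c \<odot>\<^bsub>H\<^esub> y)"
  by (cases x; cases y; simp add: assms quaternion_algebra_def algebra_simps)+

end

theory Submission
  imports Defs "HOL-Number_Theory.Number_Theory" "HOL-Library.Discrete_Functions"
begin

text \<open>
  If \<open>q = d\<close>, then \<open>q = 0\<^sup>2 + d 1\<^sup>2\<close>. In all other cases \<open>-d\<close> is a square modulo \<open>q\<close> by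
  quadratic reciprocity, and \<open>q\<close> is a square modulo \<open>d\<close>. Writing \<open>s\<^sup>2 \<equiv> -d (mod q)\<close> and \<open>t\<^sup>2 \<equiv>
  q (mod d)\<close>, the pigeonhole principle gives a nonzero integer vector with \<open>z \<equiv> s x (mod q)\<close>,
  \<open>z \<equiv> t y (mod d)\<close>, \<open>z\<^sup>2 < dq\<close>, \<open>x\<^sup>2 \<le> q\<close> and \<open>y\<^sup>2 < d\<close>. Then \<open>z\<^sup>2 + d x\<^sup>2 - q y\<^sup>2\<close> is
  divisible by \<open>dq\<close> and lies strictly between \<open>-dq\<close> and \<open>2dq\<close>, so it equals \<open>k dq\<close> with \<open>k =
  k\<^sup>2 \<in> {0, 1}\<close>. Hence \<open>q = (z\<^sup>2 + d x\<^sup>2) / (y\<^sup>2 + d k\<^sup>2)\<close> is a quotient of norms from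
  \<open>\<rat>(\<surd>(-d))\<close> and so itself a norm, which makes the quaternion algebra split.
\<close>

section \<open>Splitting of quaternion algebras\<close>

text \<open>The algebra acts on \<open>K[X]/(X^2 - \<alpha>)\<close> with basis 1, X:
  \<open>e1\<close> by multiplication with X, and \<open>e2\<close> by conjugation followed by
  multiplication with u + v X. The square of the latter map is multiplication by the norm
  \<beta>.\<close>

lemma split_quaternion_algebra_if_norm:
  fixes \<alpha> \<beta> u v :: "'a::field"
  assumes two: "(2::'a) \<noteq> 0" and "\<alpha> \<noteq> 0" "\<beta> \<noteq> 0" and norm: "\<beta> = u\<^sup>2 - \<alpha> * v\<^sup>2"
  shows "split_algebra (quaternion_algebra \<alpha> \<beta>)"
proof -
  have "(4::'a) = 2 * 2" by simp
  then have four: "(4::'a) \<noteq> 0"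
    using two by (metis mult_eq_0_iff)
  let ?H = "quaternion_algebra \<alpha> \<beta>" and ?M = "module_mat TYPE('a) 2 2"
  \<comment> \<open>\<open>e1\<close> is sent to \<open>(0, \<alpha>; 1, 0)\<close> and \<open>e2\<close> to \<open>(u, - \<alpha> v; v, - u)\<close>: they anticommute and
    have squares \<open>\<alpha>\<close> and \<open>u\<^sup>2 - \<alpha> v\<^sup>2 = \<beta>\<close>.\<close>
  define h where "h = (\<lambda>x. case x of Quat a0 a1 a2 a3 \<Rightarrow>
    mat_of_rows_list 2 [[a0 + a2 * u + a3 * \<alpha> * v, \<alpha> * (a1 - a2 * v - a3 * u)],
                        [a1 + a2 * v + a3 * u, a0 - a2 * u - a3 * \<alpha> * v]])"
  \<comment> \<open>After division of the upper right entry by \<alpha>, half-sums and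
    half-differences of the entries recover \<open>a0\<close>, \<open>a1\<close>, p = a2 u + a3
    \<alpha> v and r = a2 v + a3 u. Cramer's rule for this system of determinant \<beta> gives
    \<open>a2\<close> and \<open>a3\<close>.\<close>
  define g where "g = (\<lambda>m :: 'a mat.
    let p = (m $$ (0,0) - m $$ (1,1)) / 2; r = (m $$ (1,0) - m $$ (0,1) / \<alpha>) / 2
    in Quat ((m $$ (0,0) + m $$ (1,1)) / 2) ((m $$ (1,0) + m $$ (0,1) / \<alpha>) / 2)
         ((u * p - \<alpha> * v * r) / \<beta>) ((u * r - v * p) / \<beta>))"
  note entries = mat_eq_iff less_Suc_eq numeral_2_eq_2 h_def mat_of_rows_list_def
    scalar_prod_def module_mat_simps quaternion_algebra_def
  have carrier: "h x \<in> carrier_mat 2 2" for x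
    by (cases x) (simp add: h_def mat_of_rows_list_def numeral_2_eq_2)
  have gh: "g (h x) = x" for x
  proof (cases x)
    case (Quat a0 a1 a2 a3)
    have entries_h: "h x $$ (0, 0) = a0 + a2 * u + a3 * \<alpha> * v"
        "h x $$ (0, 1) = \<alpha> * (a1 - a2 * v - a3 * u)"
        "h x $$ (1, 0) = a1 + a2 * v + a3 * u"
        "h x $$ (1, 1) = a0 - a2 * u - a3 * \<alpha> * v"
      by (simp_all add: Quat h_def mat_of_rows_list_def)
    have "(a0 + a2 * u + a3 * \<alpha> * v - (a0 - a2 * u - a3 * \<alpha> * v)) / 2 = a2 * u + a3 * \<alpha> * v"
         "(a0 + a2 * u + a3 * \<alpha> * v + (a0 - a2 * u - a3 * \<alpha> * v)) / 2 = a0"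
         "(a1 + a2 * v + a3 * u - \<alpha> * (a1 - a2 * v - a3 * u) / \<alpha>) / 2 = a2 * v + a3 * u"
         "(a1 + a2 * v + a3 * u + \<alpha> * (a1 - a2 * v - a3 * u) / \<alpha>) / 2 = a1"
      using two \<open>\<alpha> \<noteq> 0\<close> by (simp_all add: field_simps)
    moreover have "u * (a2 * u + a3 * \<alpha> * v) - \<alpha> * v * (a2 * v + a3 * u) = a2 * \<beta>"
      "u * (a2 * v + a3 * u) - v * (a2 * u + a3 * \<alpha> * v) = a3 * \<beta>"
      by (simp_all add: norm algebra_simps power2_eq_square)
    ultimately show ?thesis
      unfolding g_def Let_def entries_h
      using \<open>\<beta> \<noteq> 0\<close> by (simp only: Quat) simp
  qed
  have hg: "h (g m) = m" if m: "m \<in> carrier_mat 2 2" for m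
  proof -
    obtain a b c d where abcd: "m $$ (0,0) = a" "m $$ (0,1) = b" "m $$ (1,0) = c" "m $$ (1,1) = d"
      by blast
    define p where "p = (a - d) / 2"
    define r where "r = (c - b / \<alpha>) / 2"
    define a2 where "a2 = (u * p - \<alpha> * v * r) / \<beta>"
    define a3 where "a3 = (u * r - v * p) / \<beta>"
    have "a2 * \<beta> = u * p - \<alpha> * v * r" "a3 * \<beta> = u * r - v * p"
      using \<open>\<beta> \<noteq> 0\<close> by (simp_all add: a2_def a3_def)
    moreover have "\<beta> * (a2 * u + a3 * \<alpha> * v) = (a2 * \<beta>) * u + (a3 * \<beta>) * \<alpha> * v"
      "\<beta> * (a2 * v + a3 * u) = (a2 * \<beta>) * v + (a3 * \<beta>) * u"
      by (simp_all add: algebra_simps)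
    moreover have "(u * p - \<alpha> * v * r) * u + (u * r - v * p) * \<alpha> * v = \<beta> * p"
      "(u * p - \<alpha> * v * r) * v + (u * r - v * p) * u = \<beta> * r"
      by (simp_all add: norm algebra_simps power2_eq_square)
    ultimately have "\<beta> * (a2 * u + a3 * \<alpha> * v) = \<beta> * p" "\<beta> * (a2 * v + a3 * u) = \<beta> * r"
      by simp_all
    then have *: "a2 * u + a3 * \<alpha> * v = p" "a2 * v + a3 * u = r"
      using \<open>\<beta> \<noteq> 0\<close> by auto
    have g: "g m = Quat ((a + d) / 2) ((c + b / \<alpha>) / 2) a2 a3"
      by (simp only: g_def abcd p_def r_def a2_def a3_def Let_def)
    have "(a + d) / 2 + a2 * u + a3 * \<alpha> * v = (a + d) / 2 + p"
         "(c + b / \<alpha>) / 2 + a2 * v + a3 * u = (c + b / \<alpha>) / 2 + r"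
         "(a + d) / 2 - a2 * u - a3 * \<alpha> * v = (a + d) / 2 - p"
         "(c + b / \<alpha>) / 2 - a2 * v - a3 * u = (c + b / \<alpha>) / 2 - r"
      by (simp_all add: * [symmetric] algebra_simps)
    moreover have "(a + d) / 2 + p = a" "(c + b / \<alpha>) / 2 + r = c" "(a + d) / 2 - p = d"
      "\<alpha> * ((c + b / \<alpha>) / 2 - r) = b"
      using two four \<open>\<alpha> \<noteq> 0\<close> by (simp_all add: p_def r_def field_simps)
    ultimately have hg_entries: "(a + d) / 2 + a2 * u + a3 * \<alpha> * v = a"
      "\<alpha> * ((c + b / \<alpha>) / 2 - a2 * v - a3 * u) = b"
      "(c + b / \<alpha>) / 2 + a2 * v + a3 * u = c"
      "(a + d) / 2 - a2 * u - a3 * \<alpha> * v = d"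
      by (simp_all only:)
    have "h (g m) = mat_of_rows_list 2 [[a, b], [c, d]]"
      by (simp only: g h_def quat.case hg_entries)
    also have "\<dots> = m"
      using m abcd by (auto simp: mat_of_rows_list_def mat_eq_iff less_Suc_eq numeral_2_eq_2)
    finally show ?thesis .
  qed
  have "h \<in> ring_iso ?H ?M"
  proof (rule ring_iso_memI)
    fix x y
    show "h (x \<otimes>\<^bsub>?H\<^esub> y) = h x \<otimes>\<^bsub>?M\<^esub> h y"
      by (cases x; cases y)
        (auto simp: entries norm algebra_simps power2_eq_square)
    show "h (x \<oplus>\<^bsub>?H\<^esub> y) = h x \<oplus>\<^bsub>?M\<^esub> h y"
      by (cases x; cases y) (auto simp: entries algebra_simps)
    show "h x \<in> carrier ?M"
      by (simp add: module_mat_simps carrier)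
  next
    show "h \<one>\<^bsub>?H\<^esub> = \<one>\<^bsub>?M\<^esub>"
      by (auto simp: entries)
    show "bij_betw h (carrier ?H) (carrier ?M)"
      by (rule bij_betw_byWitness[where f' = g])
        (auto simp: gh hg carrier module_mat_simps quaternion_algebra_def)
  qed
  moreover have "h (c \<odot>\<^bsub>?H\<^esub> x) = c \<odot>\<^bsub>?M\<^esub> h x" for c x
    by (cases x) (auto simp: entries algebra_simps)
  ultimately show ?thesis
    unfolding split_algebra_def algebra_isomorphic_def by blast
qed

section \<open>Rational norms\<close>

text \<open>Multiplying by z + s w turns a linear congruence into a quadratic one. This serves
  modulo \<open>q\<close> with a = - d and modulo \<open>d\<close> with a = q.\<close>

lemma dvd_sum_squares_diff:
  fixes z w s a m :: int
  assumes "m dvd z - s * w" "m dvd s\<^sup>2 - a"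
  shows "m dvd z\<^sup>2 - a * w\<^sup>2"
proof -
  have "z\<^sup>2 - a * w\<^sup>2 = (z - s * w) * (z + s * w) + (s\<^sup>2 - a) * w\<^sup>2"
    by (simp add: algebra_simps power2_eq_square)
  then show ?thesis
    using assms by simp
qed

text \<open>A form of Thue's lemma with two moduli: the box of (A + 1)(B + 1)(C + 1) points has more
  elements than there are pairs of residues, and the difference of two points with equal residues is
  the vector sought.\<close>

lemma exists_small_simultaneous_congruence:
  fixes q d A B C :: nat and s t :: int
  assumes "q > 0" "d > 0" and large: "q * d < (A + 1) * (B + 1) * (C + 1)"
  obtains z x y :: int where "\<bar>z\<bar> \<le> A" "\<bar>x\<bar> \<le> B" "\<bar>y\<bar> \<le> C" "(z, x, y) \<noteq> (0, 0, 0)"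
    "int q dvd z - s * x" "int d dvd z - t * y"
proof -
  define S where "S = {0..int A} \<times> {0..int B} \<times> {0..int C}"
  define f where "f = (\<lambda>(z, x, y). ((z - s * x) mod int q, (z - t * y) mod int d))"
  have "f ` S \<subseteq> {0..<int q} \<times> {0..<int d}"
    using assms by (auto simp: f_def)
  then have "card (f ` S) \<le> q * d"
    using card_mono[of "{0..<int q} \<times> {0..<int d}" "f ` S"] by (simp add: card_cartesian_product)
  also have "\<dots> < card S"
    using large by (simp add: S_def card_cartesian_product nat_add_distrib algebra_simps)
  finally have "\<not> inj_on f S"
    by (rule pigeonhole)
  then obtain a b where "a \<in> S" "b \<in> S" "a \<noteq> b" "f a = f b"
    unfolding inj_on_def by blast
  then obtain z x y z' x' y' where S: "(z, x, y) \<in> S" "(z', x', y') \<in> S"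
    and ne: "(z, x, y) \<noteq> (z', x', y')" and eq: "f (z, x, y) = f (z', x', y')"
    by (metis prod.exhaust)
  show ?thesis
  proof
    show "\<bar>z - z'\<bar> \<le> A" "\<bar>x - x'\<bar> \<le> B" "\<bar>y - y'\<bar> \<le> C"
      using S by (auto simp: S_def)
    show "(z - z', x - x', y - y') \<noteq> (0, 0, 0)"
      using ne by auto
    have "int q dvd (z - s * x) - (z' - s * x')" "int d dvd (z - t * y) - (z' - t * y')"
      using eq by (simp_all add: f_def mod_eq_dvd_iff)
    then show "int q dvd (z - z') - s * (x - x')" "int d dvd (z - z') - t * (y - y')"
      by (simp_all add: algebra_simps)
  qed
qed

text \<open>The residue conditions are those of Legendre's theorem for z^2 + d x^2 = q y^2. That
  \<open>d\<close> is not a square and is prime to \<open>q\<close> makes the bounds on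
  \<open>y\<close> and \<open>z\<close> strict.\<close>

lemma prime_eq_rational_norm:
  fixes q d :: nat
  assumes "prime q" and "coprime q d" and nonsquare: "\<And>n. n\<^sup>2 \<noteq> d"
    and "QuadRes q (- int d)" and "QuadRes d q"
  shows "\<exists>u v :: rat. of_nat q = u\<^sup>2 + of_nat d * v\<^sup>2"
proof -
  have "q > 0" using \<open>prime q\<close> by (simp add: prime_gt_0_nat)
  have "d > 0" using nonsquare[of 0] by auto
  obtain s where s: "int q dvd s\<^sup>2 - (- int d)"
    using \<open>QuadRes q (- int d)\<close> unfolding QuadRes_def cong_iff_dvd_diff by blast
  obtain t where t: "int d dvd t\<^sup>2 - int q"
    using \<open>QuadRes d q\<close> unfolding QuadRes_def cong_iff_dvd_diff by blast
  define A where "A = floor_sqrt (d * q)"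
  define B where "B = floor_sqrt q"
  define C where "C = floor_sqrt d"
  \<comment> \<open>\<open>q\<close> divides d q exactly once, so d q is not a square.\<close>
  have "A\<^sup>2 \<noteq> d * q"
  proof
    assume eq: "A\<^sup>2 = d * q"
    then have "q dvd A"
      using \<open>prime q\<close> by (metis dvd_triv_right prime_dvd_power)
    then have "q * q dvd d * q"
      using eq by (metis mult_dvd_mono power2_eq_square)
    then have "q dvd d"
      using \<open>q > 0\<close> by simp
    then have "q dvd 1"
      using \<open>coprime q d\<close> by (meson coprime_common_divisor dvd_refl)
    then show False
      using \<open>prime q\<close> by simp
  qed
  then have A: "A\<^sup>2 < d * q" and B: "B\<^sup>2 \<le> q" and C: "C\<^sup>2 < d"
    using floor_sqrt_power2_le[of "d * q"] floor_sqrt_power2_le[of q]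
      floor_sqrt_power2_le[of d] nonsquare[of C]
    by (simp_all add: A_def B_def C_def order_less_le)
  \<comment> \<open>Each of A + 1, B + 1, C + 1 exceeds the square root that it rounds down, so
    their product exceeds the root of (d q) q d, which is q d. Comparing squares keeps this in the
    natural numbers.\<close>
  have "(q * d)\<^sup>2 = d * q * q * d"
    by (simp add: power2_eq_square)
  also have "\<dots> < (A + 1)\<^sup>2 * (B + 1)\<^sup>2 * (C + 1)\<^sup>2"
    using Suc_floor_sqrt_power2_gt[of "d * q"] Suc_floor_sqrt_power2_gt[of q]
      Suc_floor_sqrt_power2_gt[of d]
    by (intro mult_strict_mono) (simp_all add: A_def B_def C_def)
  also have "\<dots> = ((A + 1) * (B + 1) * (C + 1))\<^sup>2"
    by (simp only: power_mult_distrib)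
  finally have "q * d < (A + 1) * (B + 1) * (C + 1)"
    by (rule power_less_imp_less_base) simp
  then obtain z x y :: int where bounds: "\<bar>z\<bar> \<le> A" "\<bar>x\<bar> \<le> B" "\<bar>y\<bar> \<le> C"
    and nz: "(z, x, y) \<noteq> (0, 0, 0)" and dvd: "int q dvd z - s * x" "int d dvd z - t * y"
    using exists_small_simultaneous_congruence \<open>q > 0\<close> \<open>d > 0\<close> by metis
  define f where "f = z\<^sup>2 + int d * x\<^sup>2 - int q * y\<^sup>2"
  have "int q dvd f"
    using dvd_diff[OF dvd_sum_squares_diff[OF dvd(1) s], of "int q * y\<^sup>2"] by (simp add: f_def)
  moreover have "int d dvd f"
    using dvd_add[OF dvd_sum_squares_diff[OF dvd(2) t], of "int d * x\<^sup>2"]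
    by (simp add: f_def algebra_simps)
  ultimately have "int q * int d dvd f"
    using \<open>coprime q d\<close> by (simp add: divides_mult)
  then obtain k where k: "f = int q * int d * k" ..
  have "z\<^sup>2 \<le> (int A)\<^sup>2" "x\<^sup>2 \<le> (int B)\<^sup>2" "y\<^sup>2 \<le> (int C)\<^sup>2"
    using bounds by (simp_all flip: abs_le_square_iff)
  moreover have "(int A)\<^sup>2 < int d * int q" "(int B)\<^sup>2 \<le> int q" "(int C)\<^sup>2 < int d"
    using A B C by (simp_all flip: of_nat_power of_nat_mult)
  ultimately have z: "z\<^sup>2 < int d * int q" and x: "x\<^sup>2 \<le> int q" and y: "y\<^sup>2 < int d"
    by linarith+
  have "z\<^sup>2 < int q * int d" "int d * x\<^sup>2 \<le> int q * int d" "int q * y\<^sup>2 < int q * int d"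
    using z x y \<open>q > 0\<close> by (simp_all add: mult_left_mono mult.commute[of "int q" "int d"])
  moreover have "z\<^sup>2 \<ge> 0" "int d * x\<^sup>2 \<ge> 0" "int q * y\<^sup>2 \<ge> 0"
    by simp_all
  ultimately have "- (int q * int d) < f" "f < 2 * (int q * int d)"
    unfolding f_def by linarith+
  then have "int q * int d * (- 1) < int q * int d * k" "int q * int d * k < int q * int d * 2"
    by (simp_all add: k)
  moreover have "0 < int q * int d"
    using \<open>q > 0\<close> \<open>d > 0\<close> by simp
  ultimately have "- 1 < k" "k < 2"
    by (simp_all only: mult_less_cancel_left_pos)
  then have "k = 0 \<or> k = 1"
    by linarith
  \<comment> \<open>Idempotence of \<open>k\<close> lets d k be written as d k^2, so that y^2 + d k
    is itself a norm.\<close>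
  then have "k\<^sup>2 = k" by auto
  define N where "N = y\<^sup>2 + int d * k\<^sup>2"
  have norms: "z\<^sup>2 + int d * x\<^sup>2 = int q * N"
    using k \<open>k\<^sup>2 = k\<close> by (simp add: f_def N_def algebra_simps)
  have "N \<noteq> 0"
  proof
    assume "N = 0"
    then have "y = 0"
      using \<open>d > 0\<close> by (simp add: N_def add_nonneg_eq_0_iff)
    moreover have "z = 0 \<and> x = 0"
      using norms \<open>N = 0\<close> \<open>d > 0\<close> by (simp add: add_nonneg_eq_0_iff)
    ultimately show False
      using nz by simp
  qed
  \<comment> \<open>These are the coordinates of the quotient (z + x w) / (y + k w) with w^2 = - d,
    whose denominator has norm \<open>N\<close>. The identity that follows is multiplicativity of
    the norm.\<close>
  define u :: rat where "u = of_int (z * y + int d * x * k) / of_int N"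
  define v :: rat where "v = of_int (x * y - z * k) / of_int N"
  have "(z * y + int d * x * k)\<^sup>2 + int d * (x * y - z * k)\<^sup>2 = (z\<^sup>2 + int d * x\<^sup>2) * N"
    by (simp add: N_def algebra_simps power2_eq_square)
  also have "\<dots> = int q * N\<^sup>2"
    unfolding norms by (simp add: power2_eq_square)
  finally have "rat_of_int ((z * y + int d * x * k)\<^sup>2 + int d * (x * y - z * k)\<^sup>2) =
      of_int (int q * N\<^sup>2)"
    by (rule arg_cong)
  then have "of_nat q = u\<^sup>2 + of_nat d * v\<^sup>2"
    using \<open>N \<noteq> 0\<close> by (simp add: u_def v_def power_divide divide_simps)
  then show ?thesis by blast
qed

section \<open>Quadratic residues\<close>

text \<open>Two values among - 1, 0 and 1 differ by at most 2 < p, so a congruence between them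
  modulo \<open>p\<close> is an equality.\<close>

lemma Legendre_unique:
  fixes p :: nat
  assumes "prime p" "p > 2" "[Legendre a p = c] (mod int p)" "c = 1 \<or> c = - 1 \<or> c = 0"
  shows "Legendre a p = c"
proof -
  have "Legendre a p = 1 \<or> Legendre a p = - 1 \<or> Legendre a p = 0"
    by (simp add: Legendre_def)
  then have "\<bar>Legendre a p - c\<bar> < int p"
    using assms by auto
  moreover have "int p dvd Legendre a p - c"
    using assms(3) by (simp add: cong_iff_dvd_diff)
  ultimately show ?thesis
    using zdvd_imp_le[of "int p" "\<bar>Legendre a p - c\<bar>"] by fastforce
qed

text \<open>By Euler's criterion both sides are congruent to (a b)^((p - 1)/2).\<close>

lemma Legendre_mult:
  fixes p :: nat
  assumes "prime p" "p > 2"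
  shows "Legendre (a * b) p = Legendre a p * Legendre b p"
proof (rule Legendre_unique[OF assms])
  let ?n = "(p - 1) div 2"
  have "[Legendre (a * b) p = (a * b) ^ ?n] (mod int p)"
    by (rule euler_criterion[OF assms])
  moreover have "[Legendre a p * Legendre b p = (a * b) ^ ?n] (mod int p)"
    unfolding power_mult_distrib by (intro cong_mult euler_criterion assms)
  ultimately show "[Legendre (a * b) p = Legendre a p * Legendre b p] (mod int p)"
    by (metis cong_sym cong_trans)
qed (auto simp: Legendre_def)

lemma Legendre_minus_one:
  fixes p :: nat
  assumes "prime p" "p > 2"
  shows "Legendre (- 1) p = (if p mod 4 = 1 then 1 else - 1)"
proof -
  have "Legendre (- 1) p = (- 1) ^ ((p - 1) div 2)"
    by (rule Legendre_unique[OF assms euler_criterion[OF assms]]) (simp add: minus_one_power_iff)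
  moreover have "even ((p - 1) div 2) \<longleftrightarrow> p mod 4 = 1"
    using prime_odd_nat[OF assms] by presburger
  ultimately show ?thesis
    by (simp add: minus_one_power_iff)
qed

text \<open>By Gauss's lemma the sign counts the doubles of 1, ..., (p - 1)/2 that exceed (p - 1)/2.
  The parity of their number depends on \<open>p\<close> modulo 8.\<close>

lemma Legendre_two:
  fixes p :: nat
  assumes "prime p" "p > 2"
  shows "Legendre 2 p = (if p mod 8 \<in> {1, 7} then 1 else - 1)"
proof -
  interpret GAUSS p 2
    using assms by unfold_locales (auto simp: cong_0_iff dest: zdvd_imp_le)
  let ?n = "(int p - 1) div 2"
  have "E = (\<lambda>x. x * 2) ` {?n div 2 <.. ?n}"
  proof -
    \<comment> \<open>The doubles are at most p - 1 and hence already reduced.\<close>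
    have "C = B"
    proof -
      have "x mod int p = x" if "x \<in> B" for x
        using that p_eq2 by (auto simp: B_def A_def)
      then show ?thesis by (auto simp: C_def)
    qed
    then show ?thesis
      by (auto simp: E_def B_def A_def)
  qed
  then have "card E = nat (?n - ?n div 2)"
    by (simp add: card_image inj_on_def)
  moreover have "even (nat (?n - ?n div 2)) \<longleftrightarrow> p mod 8 \<in> {1, 7}"
    using odd_p p_ge_2 by (simp add: even_nat_iff) presburger
  ultimately show ?thesis
    by (simp add: gauss_lemma minus_one_power_iff)
qed

text \<open>The symbol of \<open>q\<close> modulo \<open>p\<close> is 1, so reciprocity leaves only
  its sign, which is - 1 just when (p - 1)/2 and (q - 1)/2 are both odd.\<close>

lemma Legendre_if_QuadRes:
  fixes p q :: nat
  assumes "prime p" "p > 2" "prime q" "q > 2" "p \<noteq> q" "QuadRes p q"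
  shows "Legendre p q = (if p mod 4 = 3 \<and> q mod 4 = 3 then - 1 else 1)"
proof -
  have "\<not> p dvd q"
    using assms primes_dvd_imp_eq by blast
  then have "Legendre q p = 1"
    using \<open>QuadRes p q\<close> by (simp add: Legendre_def cong_0_iff)
  then have "Legendre p q = (- 1) ^ ((p - 1) div 2 * ((q - 1) div 2))"
    using Quadratic_Reciprocity[of p q] assms by simp
  moreover have "odd ((r - 1) div 2) \<longleftrightarrow> r mod 4 = 3" if "odd r" for r :: nat
    using that by presburger
  ultimately show ?thesis
    using assms prime_odd_nat by (auto simp: minus_one_power_iff)
qed


section \<open>Criteria in terms of residues\<close>

lemma QuadRes_dvd: "QuadRes m a \<Longrightarrow> n dvd m \<Longrightarrow> QuadRes n a"
  unfolding QuadRes_def by (meson cong_dvd_modulus)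

text \<open>The squares modulo \<open>d\<close> are enumerated as a list so that simplification
  decides membership for a concrete residue of \<open>q\<close>. The modulus \<open>m\<close> may be
  a proper multiple of \<open>d\<close>, as in most of the residue conditions.\<close>

lemma QuadRes_if_mod:
  fixes q d m :: nat
  assumes "d dvd m" and "int (q mod m) mod d \<in> set (map (\<lambda>t. t\<^sup>2 mod int d) [0..int d - 1])"
  shows "QuadRes d q"
proof -
  have "int (q mod m) mod int d = int q mod int d"
    using \<open>d dvd m\<close> by (metis mod_mod_cancel of_nat_mod)
  then show ?thesis
    using assms(2) by (auto simp: QuadRes_def cong_def)
qed

lemma coprime_if_mod:
  fixes q d m :: nat
  assumes "d dvd m" "gcd (q mod m) d = 1"
  shows "coprime q d"
proof -
  have "q mod m mod d = q mod d"
    using \<open>d dvd m\<close> by (rule mod_mod_cancel)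
  then show ?thesis
    using assms(2) by (metis coprime_iff_gcd_eq_1 gcd.commute gcd_red_nat)
qed

text \<open>\<open>n\<close> certifies that \<open>d\<close> is not a square by placing it between
  consecutive squares, which is easy to check for numerals.\<close>

lemma split_quaternion_algebra_if_QuadRes:
  fixes q d n :: nat
  assumes "prime q" "coprime q d" and between: "n\<^sup>2 < d" "d < (n + 1)\<^sup>2"
    and "QuadRes q (- int d)" "QuadRes d q"
  shows "split_algebra (quaternion_algebra (- of_nat d :: rat) (of_nat q))"
proof -
  have "m\<^sup>2 \<noteq> d" for m
  proof
    assume "m\<^sup>2 = d"
    then have "n < m" "m < n + 1"
      using between by (auto intro: power_less_imp_less_base)
    then show False by simp
  qed
  then obtain u v :: rat where "of_nat q = u\<^sup>2 + of_nat d * v\<^sup>2"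
    using prime_eq_rational_norm assms by blast
  then show ?thesis
    using \<open>prime q\<close> between by (intro split_quaternion_algebra_if_norm[of _ _ u v]) auto
qed

lemma split_quaternion_algebra_if_eq:
  fixes q :: nat
  assumes "q > 0"
  shows "split_algebra (quaternion_algebra (- of_nat q :: rat) (of_nat q))"
  using assms by (intro split_quaternion_algebra_if_norm[of _ _ 0 1]) auto

lemma QuadRes_if_Legendre: "Legendre a p = 1 \<Longrightarrow> QuadRes p a"
  by (simp add: Legendre_def split: if_splits)

text \<open>\<open>QuadRes d q\<close> passes to each odd prime factor of \<open>d\<close>, where
  reciprocity applies. Keeping \<open>d\<close> in the hypotheses lets one pair of facts serve all
  factors.\<close>

lemma Legendre_prime_divisor:
  fixes p q d :: nat
  assumes "prime p" "p > 2" "prime q" "q > 2" "coprime q d" "QuadRes d q" "p dvd d"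
  shows "Legendre p q = (if p mod 4 = 3 \<and> q mod 4 = 3 then - 1 else 1)"
proof (rule Legendre_if_QuadRes)
  show "p \<noteq> q"
    using assms by (metis coprime_common_divisor_nat dvd_refl not_prime_1)
  show "QuadRes p q"
    using assms QuadRes_dvd[of d q p] by simp
qed (use assms in auto)

section \<open>The eleven residue conditions\<close>

theorem proposition2p4:
  fixes q :: nat
  assumes "prime q"
  shows
    "(q mod 3 = 1 \<or> q = 3 \<longrightarrow>
       split_algebra (quaternion_algebra (- 3 :: rat) (of_nat q))) \<and>
     (q mod 20 \<in> {1, 9} \<or> q = 5 \<longrightarrow>
       split_algebra (quaternion_algebra (- 5 :: rat) (of_nat q))) \<and>
     (q mod 24 \<in> {1, 7} \<longrightarrow>
       split_algebra (quaternion_algebra (- 6 :: rat) (of_nat q))) \<and>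
     (q mod 7 \<in> {1, 2, 4} \<or> q = 7 \<longrightarrow>
       split_algebra (quaternion_algebra (- 7 :: rat) (of_nat q))) \<and>
     (q mod 40 \<in> {1, 9, 11, 19} \<longrightarrow>
       split_algebra (quaternion_algebra (- 10 :: rat) (of_nat q))) \<and>
     (q mod 52 \<in> {1, 9, 17, 25, 29, 49} \<longrightarrow>
       split_algebra (quaternion_algebra (- 13 :: rat) (of_nat q))) \<and>
     (q mod 56 \<in> {1, 9, 15, 23, 25, 39} \<longrightarrow>
       split_algebra (quaternion_algebra (- 14 :: rat) (of_nat q))) \<and>
     (q mod 60 \<in> {1, 19, 31, 49} \<longrightarrow>
       split_algebra (quaternion_algebra (- 15 :: rat) (of_nat q))) \<and>
     (q mod 84 \<in> {1, 25, 37} \<longrightarrow>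
       split_algebra (quaternion_algebra (- 21 :: rat) (of_nat q))) \<and>
     (q mod 88 \<in> {1, 9, 15, 23, 25, 31, 47, 49, 71, 81} \<longrightarrow>
       split_algebra (quaternion_algebra (- 22 :: rat) (of_nat q))) \<and>
     (q mod 120 \<in> {1, 31, 49, 79} \<longrightarrow>
       split_algebra (quaternion_algebra (- 30 :: rat) (of_nat q)))"
proof -
  have case3: "split_algebra (quaternion_algebra (- 3 :: rat) (of_nat q))"
    if residue: "q mod 3 = 1"
  proof -
    have coprime: "coprime q 3"
      by (rule coprime_if_mod[of 3 3]) (use residue in \<open>auto simp: gcd_non_0_nat\<close>)
    have square: "QuadRes (int 3) q"
      by (rule QuadRes_if_mod[of 3 3]) (use residue in \<open>auto simp: upto_rec1\<close>)
    have "q > 2"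
      using residue prime_ge_2_nat[OF assms] by (cases "q = 2") auto
    note legendre = Legendre_mult[OF assms this] Legendre_minus_one[OF assms this]
      Legendre_two[OF assms this] Legendre_prime_divisor[OF _ _ assms this coprime square]
    have L3: "Legendre 3 q = (if q mod 4 = 3 then - 1 else 1)"
      using legendre(4)[of 3] by simp
    \<comment> \<open>The condition modulo 3 leaves \<open>q\<close> modulo 4 open, but the symbols
      of - 1 and 3 change sign together.\<close>
    have residue': "q mod 4 = 1 \<or> q mod 4 = 3"
      using prime_odd_nat[OF assms \<open>q > 2\<close>] by presburger
    have "Legendre (- 3) q = Legendre (- 1) q * Legendre 3 q"
      using legendre(1)[of "- 1" 3] by simp
    also have "\<dots> = 1"
      using residue' by (auto simp: legendre(2) L3)
    finally show ?thesis
      using split_quaternion_algebra_if_QuadRes[of q 3 1] assms coprime square QuadRes_if_Legendre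
      by (simp add: power2_eq_square)
  qed
  have case5: "split_algebra (quaternion_algebra (- 5 :: rat) (of_nat q))"
    if residue: "q mod 20 \<in> {1, 9}"
  proof -
    have coprime: "coprime q 5"
      by (rule coprime_if_mod[of 5 20]) (use residue in \<open>auto simp: gcd_non_0_nat\<close>)
    have square: "QuadRes (int 5) q"
      by (rule QuadRes_if_mod[of 5 20]) (use residue in \<open>auto simp: upto_rec1\<close>)
    have "q > 2"
      using residue prime_ge_2_nat[OF assms] by (cases "q = 2") auto
    note legendre = Legendre_mult[OF assms this] Legendre_minus_one[OF assms this]
      Legendre_two[OF assms this] Legendre_prime_divisor[OF _ _ assms this coprime square]
    have L5: "Legendre 5 q = 1"
      using legendre(4)[of 5] by simp
    \<comment> \<open>As 5 is 1 modulo 4, its symbol carries no sign to offset that of - 1, so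
      \<open>q\<close> has to be 1 modulo 4.\<close>
    have residue': "q mod 4 = 1"
      using residue mod_mod_cancel[of 4 20 q] by auto
    have "Legendre (- 5) q = Legendre (- 1) q * Legendre 5 q"
      using legendre(1)[of "- 1" 5] by simp
    also have "\<dots> = 1"
      using residue' by (auto simp: legendre(2) L5)
    finally show ?thesis
      using split_quaternion_algebra_if_QuadRes[of q 5 2] assms coprime square QuadRes_if_Legendre
      by simp
  qed
  have case6: "split_algebra (quaternion_algebra (- 6 :: rat) (of_nat q))"
    if residue: "q mod 24 \<in> {1, 7}"
  proof -
    have coprime: "coprime q 6"
      by (rule coprime_if_mod[of 6 24]) (use residue in \<open>auto simp: gcd_non_0_nat\<close>)
    have square: "QuadRes (int 6) q"
      by (rule QuadRes_if_mod[of 6 24]) (use residue in \<open>auto simp: upto_rec1\<close>)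
    have "q > 2"
      using residue prime_ge_2_nat[OF assms] by (cases "q = 2") auto
    note legendre = Legendre_mult[OF assms this] Legendre_minus_one[OF assms this]
      Legendre_two[OF assms this] Legendre_prime_divisor[OF _ _ assms this coprime square]
    have L3: "Legendre 3 q = (if q mod 4 = 3 then - 1 else 1)"
      using legendre(4)[of 3] by simp
    \<comment> \<open>The symbols of - 1 and 3 agree, so 2 has to be a residue: \<open>q\<close> is
      1 or 7 modulo 8.\<close>
    have residue': "q mod 8 = 1 \<and> q mod 4 = 1 \<or> q mod 8 = 7 \<and> q mod 4 = 3"
      using residue mod_mod_cancel[of 4 24 q] mod_mod_cancel[of 8 24 q] by auto
    have "Legendre (- 6) q = Legendre (- 1) q * Legendre 2 q * Legendre 3 q"
      using legendre(1)[of "- 1" 6] legendre(1)[of 2 3] by simp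
    also have "\<dots> = 1"
      using residue' by (auto simp: legendre(2,3) L3)
    finally show ?thesis
      using split_quaternion_algebra_if_QuadRes[of q 6 2] assms coprime square QuadRes_if_Legendre
      by simp
  qed
  have case7: "split_algebra (quaternion_algebra (- 7 :: rat) (of_nat q))"
    if residue: "q mod 7 \<in> {1, 2, 4}"
  proof -
    have coprime: "coprime q 7"
      by (rule coprime_if_mod[of 7 7]) (use residue in \<open>auto simp: gcd_non_0_nat\<close>)
    have square: "QuadRes (int 7) q"
      by (rule QuadRes_if_mod[of 7 7]) (use residue in \<open>auto simp: upto_rec1\<close>)
    have "QuadRes q (- 7)"
    proof (cases "q = 2")
      case True
      then show ?thesis
        by (auto simp: QuadRes_def cong_def intro!: exI[of _ 1])
    next
      case False
      then have "q > 2"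
        using prime_ge_2_nat[OF assms] by simp
      note legendre = Legendre_mult[OF assms this] Legendre_minus_one[OF assms this]
        Legendre_two[OF assms this] Legendre_prime_divisor[OF _ _ assms this coprime square]
      have L7: "Legendre 7 q = (if q mod 4 = 3 then - 1 else 1)"
        using legendre(4)[of 7] by simp
      have residue': "q mod 4 = 1 \<or> q mod 4 = 3"
        using prime_odd_nat[OF assms \<open>q > 2\<close>] by presburger
      have "Legendre (- 7) q = Legendre (- 1) q * Legendre 7 q"
        using legendre(1)[of "- 1" 7] by simp
      also have "\<dots> = 1"
        using residue' by (auto simp: legendre(2) L7)
      finally show ?thesis
        by (rule QuadRes_if_Legendre)
    qed
    then show ?thesis
      using split_quaternion_algebra_if_QuadRes[of q 7 2] assms coprime square by simp
  qed
  have case10: "split_algebra (quaternion_algebra (- 10 :: rat) (of_nat q))"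
    if residue: "q mod 40 \<in> {1, 9, 11, 19}"
  proof -
    have coprime: "coprime q 10"
      by (rule coprime_if_mod[of 10 40]) (use residue in \<open>auto simp: gcd_non_0_nat\<close>)
    have square: "QuadRes (int 10) q"
      by (rule QuadRes_if_mod[of 10 40]) (use residue in \<open>auto simp: upto_rec1\<close>)
    have "q > 2"
      using residue prime_ge_2_nat[OF assms] by (cases "q = 2") auto
    note legendre = Legendre_mult[OF assms this] Legendre_minus_one[OF assms this]
      Legendre_two[OF assms this] Legendre_prime_divisor[OF _ _ assms this coprime square]
    have L5: "Legendre 5 q = 1"
      using legendre(4)[of 5] by simp
    \<comment> \<open>Since the symbol of 5 is 1, those of - 1 and 2 must agree, which happens for 1
      and 3 modulo 8.\<close>
    have residue': "q mod 8 = 1 \<and> q mod 4 = 1 \<or> q mod 8 = 3 \<and> q mod 4 = 3"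
      using residue mod_mod_cancel[of 4 40 q] mod_mod_cancel[of 8 40 q] by auto
    have "Legendre (- 10) q = Legendre (- 1) q * Legendre 2 q * Legendre 5 q"
      using legendre(1)[of "- 1" 10] legendre(1)[of 2 5] by simp
    also have "\<dots> = 1"
      using residue' by (auto simp: legendre(2,3) L5)
    finally show ?thesis
      using split_quaternion_algebra_if_QuadRes[of q 10 3] assms coprime square QuadRes_if_Legendre
      by simp
  qed
  have case13: "split_algebra (quaternion_algebra (- 13 :: rat) (of_nat q))"
    if residue: "q mod 52 \<in> {1, 9, 17, 25, 29, 49}"
  proof -
    have coprime: "coprime q 13"
      by (rule coprime_if_mod[of 13 52]) (use residue in \<open>auto simp: gcd_non_0_nat\<close>)
    have square: "QuadRes (int 13) q"
      by (rule QuadRes_if_mod[of 13 52]) (use residue in \<open>auto simp: upto_rec1\<close>)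
    have "q > 2"
      using residue prime_ge_2_nat[OF assms] by (cases "q = 2") auto
    note legendre = Legendre_mult[OF assms this] Legendre_minus_one[OF assms this]
      Legendre_two[OF assms this] Legendre_prime_divisor[OF _ _ assms this coprime square]
    have L13: "Legendre 13 q = 1"
      using legendre(4)[of 13] by simp
    \<comment> \<open>13 is 1 modulo 4, so, as for 5, - 1 has to be a residue.\<close>
    have residue': "q mod 4 = 1"
      using residue mod_mod_cancel[of 4 52 q] by auto
    have "Legendre (- 13) q = Legendre (- 1) q * Legendre 13 q"
      using legendre(1)[of "- 1" 13] by simp
    also have "\<dots> = 1"
      using residue' by (auto simp: legendre(2) L13)
    finally show ?thesis
      using split_quaternion_algebra_if_QuadRes[of q 13 3] assms coprime square QuadRes_if_Legendre
      by simp
  qed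
  have case14: "split_algebra (quaternion_algebra (- 14 :: rat) (of_nat q))"
    if residue: "q mod 56 \<in> {1, 9, 15, 23, 25, 39}"
  proof -
    have coprime: "coprime q 14"
      by (rule coprime_if_mod[of 14 56]) (use residue in \<open>auto simp: gcd_non_0_nat\<close>)
    have square: "QuadRes (int 14) q"
      by (rule QuadRes_if_mod[of 14 56]) (use residue in \<open>auto simp: upto_rec1\<close>)
    have "q > 2"
      using residue prime_ge_2_nat[OF assms] by (cases "q = 2") auto
    note legendre = Legendre_mult[OF assms this] Legendre_minus_one[OF assms this]
      Legendre_two[OF assms this] Legendre_prime_divisor[OF _ _ assms this coprime square]
    have L7: "Legendre 7 q = (if q mod 4 = 3 then - 1 else 1)"
      using legendre(4)[of 7] by simp
    \<comment> \<open>7 is 3 modulo 4, so its symbol cancels that of - 1, and 2 has to be a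
      residue.\<close>
    have residue': "q mod 8 = 1 \<and> q mod 4 = 1 \<or> q mod 8 = 7 \<and> q mod 4 = 3"
      using residue mod_mod_cancel[of 4 56 q] mod_mod_cancel[of 8 56 q] by auto
    have "Legendre (- 14) q = Legendre (- 1) q * Legendre 2 q * Legendre 7 q"
      using legendre(1)[of "- 1" 14] legendre(1)[of 2 7] by simp
    also have "\<dots> = 1"
      using residue' by (auto simp: legendre(2,3) L7)
    finally show ?thesis
      using split_quaternion_algebra_if_QuadRes[of q 14 3] assms coprime square QuadRes_if_Legendre
      by simp
  qed
  have case15: "split_algebra (quaternion_algebra (- 15 :: rat) (of_nat q))"
    if residue: "q mod 60 \<in> {1, 19, 31, 49}"
  proof -
    have coprime: "coprime q 15"
      by (rule coprime_if_mod[of 15 60]) (use residue in \<open>auto simp: gcd_non_0_nat\<close>)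
    have square: "QuadRes (int 15) q"
      by (rule QuadRes_if_mod[of 15 60]) (use residue in \<open>auto simp: upto_rec1\<close>)
    have "q > 2"
      using residue prime_ge_2_nat[OF assms] by (cases "q = 2") auto
    note legendre = Legendre_mult[OF assms this] Legendre_minus_one[OF assms this]
      Legendre_two[OF assms this] Legendre_prime_divisor[OF _ _ assms this coprime square]
    have L3: "Legendre 3 q = (if q mod 4 = 3 then - 1 else 1)"
      using legendre(4)[of 3] by simp
    have L5: "Legendre 5 q = 1"
      using legendre(4)[of 5] by simp
    \<comment> \<open>The symbol of 5 is 1 and those of - 1 and 3 cancel, so both odd classes modulo
      4 are admissible.\<close>
    have residue': "q mod 4 = 1 \<or> q mod 4 = 3"
      using residue mod_mod_cancel[of 4 60 q] by auto
    have "Legendre (- 15) q = Legendre (- 1) q * Legendre 3 q * Legendre 5 q"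
      using legendre(1)[of "- 1" 15] legendre(1)[of 3 5] by simp
    also have "\<dots> = 1"
      using residue' by (auto simp: legendre(2) L3 L5)
    finally show ?thesis
      using split_quaternion_algebra_if_QuadRes[of q 15 3] assms coprime square QuadRes_if_Legendre
      by simp
  qed
  have case21: "split_algebra (quaternion_algebra (- 21 :: rat) (of_nat q))"
    if residue: "q mod 84 \<in> {1, 25, 37}"
  proof -
    have coprime: "coprime q 21"
      by (rule coprime_if_mod[of 21 84]) (use residue in \<open>auto simp: gcd_non_0_nat\<close>)
    have square: "QuadRes (int 21) q"
      by (rule QuadRes_if_mod[of 21 84]) (use residue in \<open>auto simp: upto_rec1\<close>)
    have "q > 2"
      using residue prime_ge_2_nat[OF assms] by (cases "q = 2") auto
    note legendre = Legendre_mult[OF assms this] Legendre_minus_one[OF assms this]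
      Legendre_two[OF assms this] Legendre_prime_divisor[OF _ _ assms this coprime square]
    have L3: "Legendre 3 q = (if q mod 4 = 3 then - 1 else 1)"
      using legendre(4)[of 3] by simp
    have L7: "Legendre 7 q = (if q mod 4 = 3 then - 1 else 1)"
      using legendre(4)[of 7] by simp
    \<comment> \<open>The symbols of 3 and 7 cancel each other, so - 1 has to be a residue.\<close>
    have residue': "q mod 4 = 1"
      using residue mod_mod_cancel[of 4 84 q] by auto
    have "Legendre (- 21) q = Legendre (- 1) q * Legendre 3 q * Legendre 7 q"
      using legendre(1)[of "- 1" 21] legendre(1)[of 3 7] by simp
    also have "\<dots> = 1"
      using residue' by (auto simp: legendre(2) L3 L7)
    finally show ?thesis
      using split_quaternion_algebra_if_QuadRes[of q 21 4] assms coprime square QuadRes_if_Legendre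
      by simp
  qed
  have case22: "split_algebra (quaternion_algebra (- 22 :: rat) (of_nat q))"
    if residue: "q mod 88 \<in> {1, 9, 15, 23, 25, 31, 47, 49, 71, 81}"
  proof -
    have coprime: "coprime q 22"
      by (rule coprime_if_mod[of 22 88]) (use residue in \<open>auto simp: gcd_non_0_nat\<close>)
    have square: "QuadRes (int 22) q"
      by (rule QuadRes_if_mod[of 22 88]) (use residue in \<open>auto simp: upto_rec1\<close>)
    have "q > 2"
      using residue prime_ge_2_nat[OF assms] by (cases "q = 2") auto
    note legendre = Legendre_mult[OF assms this] Legendre_minus_one[OF assms this]
      Legendre_two[OF assms this] Legendre_prime_divisor[OF _ _ assms this coprime square]
    have L11: "Legendre 11 q = (if q mod 4 = 3 then - 1 else 1)"
      using legendre(4)[of 11] by simp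
    \<comment> \<open>The symbols of - 1 and 11 cancel, as those of - 1 and 3 do for d = 6.\<close>
    have residue': "q mod 8 = 1 \<and> q mod 4 = 1 \<or> q mod 8 = 7 \<and> q mod 4 = 3"
      using residue mod_mod_cancel[of 4 88 q] mod_mod_cancel[of 8 88 q] by auto
    have "Legendre (- 22) q = Legendre (- 1) q * Legendre 2 q * Legendre 11 q"
      using legendre(1)[of "- 1" 22] legendre(1)[of 2 11] by simp
    also have "\<dots> = 1"
      using residue' by (auto simp: legendre(2,3) L11)
    finally show ?thesis
      using split_quaternion_algebra_if_QuadRes[of q 22 4] assms coprime square QuadRes_if_Legendre
      by simp
  qed
  have case30: "split_algebra (quaternion_algebra (- 30 :: rat) (of_nat q))"
    if residue: "q mod 120 \<in> {1, 31, 49, 79}"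
  proof -
    have coprime: "coprime q 30"
      by (rule coprime_if_mod[of 30 120]) (use residue in \<open>auto simp: gcd_non_0_nat\<close>)
    have square: "QuadRes (int 30) q"
      by (rule QuadRes_if_mod[of 30 120]) (use residue in \<open>auto simp: upto_rec1\<close>)
    have "q > 2"
      using residue prime_ge_2_nat[OF assms] by (cases "q = 2") auto
    note legendre = Legendre_mult[OF assms this] Legendre_minus_one[OF assms this]
      Legendre_two[OF assms this] Legendre_prime_divisor[OF _ _ assms this coprime square]
    have L3: "Legendre 3 q = (if q mod 4 = 3 then - 1 else 1)"
      using legendre(4)[of 3] by simp
    have L5: "Legendre 5 q = 1"
      using legendre(4)[of 5] by simp
    \<comment> \<open>Again - 1 and 3 cancel and 5 contributes 1, which leaves the symbol of
      2.\<close>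
    have residue': "q mod 8 = 1 \<and> q mod 4 = 1 \<or> q mod 8 = 7 \<and> q mod 4 = 3"
      using residue mod_mod_cancel[of 4 120 q] mod_mod_cancel[of 8 120 q] by auto
    have "Legendre (- 30) q = Legendre (- 1) q * Legendre 2 q * Legendre 3 q * Legendre 5 q"
      using legendre(1)[of "- 1" 30] legendre(1)[of 2 15] legendre(1)[of 3 5] by simp
    also have "\<dots> = 1"
      using residue' by (auto simp: legendre(2,3) L3 L5)
    finally show ?thesis
      using split_quaternion_algebra_if_QuadRes[of q 30 5] assms coprime square QuadRes_if_Legendre
      by simp
  qed
  \<comment> \<open>The primes 3, 5 and 7 that coincide with d remain; there coprimality
    fails.\<close>
  have "split_algebra (quaternion_algebra (- of_nat q :: rat) (of_nat q))"
    using assms by (simp add: split_quaternion_algebra_if_eq prime_gt_0_nat)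
  then show ?thesis
    using case3 case5 case6 case7 case10 case13 case14 case15 case21 case22 case30 by auto
qed

end
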